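(* Let $\mathcal{A}\in\mathbb{C}^{n_1\times n_2\times n_3}$, $\mathcal{G}\in\mathbb{C}^{n_2\times n_1\times n_3}$ and let $\mathcal{G}=\mathcal{U}*_c\mathcal{S}*_c\mathcal{V}^H$ be the C-SVD of $\mathcal{G}$. Suppose that $\mathrm{rank}(L(\mathcal{S})^{(i)})=r_i$, $i=1,\dots,n_3$. Represent $\mathcal{A}$ as $\mathcal{A}=\mathcal{V}*_c\mathcal{B}*_c\mathcal{U}^H$, where $\mathcal{B}\in\mathbb{C}^{n_1\times n_2\times n_3}$ satisfies $$L(\mathcal{B})^{(i)}=\begin{bmatrix}\mathbf{X}_i&\bigstar\\ \bigstar&\bigstar\end{bmatrix},\qquad \mathbf{X}_i\in\mathbb{C}^{r_i\times r_i},\quad i=1,\dots,n_3,$$ with $\bigstar$ denoting unspecified blocks. Then $\mathcal{A}^{\parallel\mathcal{G}}$ exists if and only if all $\mathbf{X}_i$, $i=1,\dots,n_3$, are nonsingular. In particular, if $\mathrm{rank}(L(\mathcal{S})^{(i)})=r$ for all $i=1,\dots,n_3$, then (when $\mathcal{A}^{\parallel\mathcal{G}}$ exists) $$\mathcal{A}^{\parallel\mathcal{G}}=\mathcal{U}*_c\begin{bmatrix}\mathcal{X}^{-1}&\mathcal{O}\\ \mathcal{O}&\mathcal{O}\end{bmatrix}*_c\mathcal{V}^H,$$ where $\mathcal{X}\in\mathbb{C}^{r\times r\times n_3}$ is the tensor with $L(\mathcal{X})^{(i)}=\mathbf{X}_i$, $i=1,\dots,n_3$.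
   Context: For a third-order tensor $\mathcal{A}\in\mathbb{C}^{n_1\times n_2\times n_3}$, $\mathcal{A}^{(i)}=\mathcal{A}(:,:,i)\in\mathbb{C}^{n_1\times n_2}$ denotes its $i$-th frontal slice. Let $\mathbf{C}_{n_3}$ be the $n_3\times n_3$ orthogonal DCT matrix, with entries $(\mathbf{C}_{n_3})_{jk}=\sqrt{(2-\delta_{j1})/n_3}\,\cos\big(\tfrac{(j-1)(2k-1)\pi}{2n_3}\big)$; let $\mathbf{W}$ be the diagonal matrix whose diagonal is the first column of $\mathbf{C}_{n_3}$; let $\mathbf{Z}$ be the $n_3\times n_3$ matrix with ones on the first superdiagonal and zeros elsewhere; and put $\mathbf{M}=\mathbf{W}^{-1}\mathbf{C}_{n_3}(\mathbf{I}+\mathbf{Z})$, an invertible matrix. Define the linear bijection $L$ on tensors with third dimension $n_3$ by $L(\mathcal{A})_{ijk}=\sum_{l=1}^{n_3}\mathbf{M}_{kl}\mathcal{A}_{ijl}$. The C-product of $\mathcal{A}\in\mathbb{C}^{n_1\times n_2\times n_3}$ and $\mathcal{B}\in\mathbb{C}^{n_2\times l\times n_3}$ is the tensor $\mathcal{A}*_c\mathcal{B}\in\mathbb{C}^{n_1\times l\times n_3}$ determined by $L(\mathcal{A}*_c\mathcal{B})^{(i)}=L(\mathcal{A})^{(i)}L(\mathcal{B})^{(i)}$, $i=1,\dots,n_3$. The conjugate transpose $\mathcal{A}^H$ is determined by $L(\mathcal{A}^H)^{(i)}=(L(\mathcal{A})^{(i)})^H$ for all $i$. The identity tensor $\mathcal{I}\in\mathbb{C}^{n\times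 n\times n_3}$ is determined by $L(\mathcal{I})^{(i)}=\mathbf{I}_n$ for all $i$. The inverse $\mathcal{B}^{-1}$ of $\mathcal{B}\in\mathbb{C}^{n\times n\times n_3}$ is the tensor with $\mathcal{B}*_c\mathcal{B}^{-1}=\mathcal{B}^{-1}*_c\mathcal{B}=\mathcal{I}$. $\mathcal{Q}\in\mathbb{C}^{n\times n\times n_3}$ is unitary if $\mathcal{Q}^H*_c\mathcal{Q}=\mathcal{Q}*_c\mathcal{Q}^H=\mathcal{I}$. Block notation partitions tensors along the first two modes; $\mathcal{O}$ denotes zero tensors. A C-SVD of $\mathcal{G}\in\mathbb{C}^{n_2\times n_1\times n_3}$ is a factorization $\mathcal{G}=\mathcal{U}*_c\mathcal{S}*_c\mathcal{V}^H$ with $\mathcal{U}\in\mathbb{C}^{n_2\times n_2\times n_3}$, $\mathcal{V}\in\mathbb{C}^{n_1\times n_1\times n_3}$ unitary and $\mathcal{S}\in\mathbb{C}^{n_2\times n_1\times n_3}$ F-diagonal (all frontal slices diagonal), obtained from singular value decompositions $L(\mathcal{G})^{(i)}=L(\mathcal{U})^{(i)}L(\mathcal{S})^{(i)}(L(\mathcal{V})^{(i)})^H$ in which the nonzero singular values come first, i.e. $L(\mathcal{S})^{(i)}=\begin{bmatrix}\overline{\mathbf{S}}_i&\mathbf{O}\\ \mathbf{O}&\mathbf{O}\end{bmatrix}$ with $\overline{\mathbf{S}}_i$ a nonsingular diagonal matrix of size $\mathrm{rank}(L(\mathcal{S})^{(i)})$. $\mathcal{A}\in\mathbb{C}^{n_1\times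 n_2\times n_3}$ is invertible along $\mathcal{G}\in\mathbb{C}^{n_2\times n_1\times n_3}$ if there exist $\mathcal{Y}\in\mathbb{C}^{n_2\times n_1\times n_3}$, $\mathcal{E}\in\mathbb{C}^{n_1\times n_1\times n_3}$ and $\mathcal{F}\in\mathbb{C}^{n_2\times n_2\times n_3}$ such that $\mathcal{Y}*_c\mathcal{A}*_c\mathcal{G}=\mathcal{G}$, $\mathcal{G}*_c\mathcal{A}*_c\mathcal{Y}=\mathcal{G}$, $\mathcal{Y}=\mathcal{G}*_c\mathcal{E}$ and $\mathcal{Y}^H=\mathcal{G}^H*_c\mathcal{F}$; such a $\mathcal{Y}$ is unique, is called the inverse of $\mathcal{A}$ along $\mathcal{G}$, and is denoted $\mathcal{A}^{\parallel\mathcal{G}}$ (one then says $\mathcal{A}^{\parallel\mathcal{G}}$ exists). *)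

theory Defs
  imports
    Complex_Main
    "Jordan_Normal_Form.Gauss_Jordan_Elimination"
    "Jordan_Normal_Form.Schur_Decomposition"
    "Jordan_Normal_Form.DL_Rank"
begin

text \<open>
  A third-order tensor of size \<open>n1 \<times> n2 \<times> n3\<close> is an \<open>n1 \<times> n2\<close> matrix whose \<open>(i,j)\<close> entry is the
  mode-3 tube \<open>A(i,j,:)\<close>, a vector of length \<open>n3\<close>. Block notation along the first two modes is then
  \<^const>\<open>four_block_mat\<close>. All indices start at 0.
\<close>

type_synonym tensor = "complex vec mat"

definition carrier_tensor :: "nat \<Rightarrow> nat \<Rightarrow> nat \<Rightarrow> tensor set" where
  "carrier_tensor n1 n2 n3 =
     {A \<in> carrier_mat n1 n2. \<forall>i<n1. \<forall>j<n2. A $$ (i, j) \<in> carrier_vec n3}"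

definition zero_tensor :: "nat \<Rightarrow> nat \<Rightarrow> nat \<Rightarrow> tensor" where
  "zero_tensor n1 n2 n3 = mat n1 n2 (\<lambda>_. 0\<^sub>v n3)"

definition frontal_slice :: "tensor \<Rightarrow> nat \<Rightarrow> complex mat" where
  "frontal_slice A k = map_mat (\<lambda>v. v $ k) A"

text \<open>The matrix \<open>M = W\<^sup>-\<^sup>1 C (I + Z)\<close>; the angle \<open>(j-1)(2k-1)\<pi>/(2n)\<close> of the 1-based formula for \<open>C\<close>
  becomes \<open>j(2k+1)\<pi>/(2n)\<close>.\<close>

definition dct_mat :: "nat \<Rightarrow> real mat" where
  "dct_mat n = mat n n (\<lambda>(j, k).
     sqrt ((2 - of_bool (j = 0)) / real n) * cos (real (j * (2 * k + 1)) * pi / (2 * real n)))"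

definition W_mat :: "nat \<Rightarrow> real mat" where
  "W_mat n = mat_diag n (\<lambda>j. dct_mat n $$ (j, 0))"

definition Z_mat :: "nat \<Rightarrow> real mat" where
  "Z_mat n = mat n n (\<lambda>(i, j). if j = Suc i then 1 else 0)"

definition M_mat :: "nat \<Rightarrow> real mat" where
  "M_mat n = the (mat_inverse (W_mat n)) * dct_mat n * (1\<^sub>m n + Z_mat n)"

definition L :: "nat \<Rightarrow> tensor \<Rightarrow> tensor" where
  "L n3 A = map_mat (\<lambda>v. map_mat complex_of_real (M_mat n3) *\<^sub>v v) A"

abbreviation L_slice :: "nat \<Rightarrow> tensor \<Rightarrow> nat \<Rightarrow> complex mat" where
  "L_slice n3 A i \<equiv> frontal_slice (L n3 A) i"

text \<open>The \<open>n1 \<times> n2 \<times> n3\<close> tensor determined by prescribing all frontal slices of its image under \<open>L\<close>.\<close>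

definition tensor_of_L_slices :: "nat \<Rightarrow> nat \<Rightarrow> nat \<Rightarrow> (nat \<Rightarrow> complex mat) \<Rightarrow> tensor" where
  "tensor_of_L_slices n1 n2 n3 F =
     (THE A. A \<in> carrier_tensor n1 n2 n3 \<and> (\<forall>i<n3. L_slice n3 A i = F i))"

definition c_prod :: "tensor \<Rightarrow> nat \<Rightarrow> tensor \<Rightarrow> tensor"
    (\<open>(_ \<star>\<^bsub>_\<^esub>/ _)\<close> [70, 0, 71] 70) where
  "A \<star>\<^bsub>n3\<^esub> B =
     tensor_of_L_slices (dim_row A) (dim_col B) n3 (\<lambda>i. L_slice n3 A i * L_slice n3 B i)"

definition tensor_adjoint :: "nat \<Rightarrow> tensor \<Rightarrow> tensor" where
  "tensor_adjoint n3 A =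
     tensor_of_L_slices (dim_col A) (dim_row A) n3 (\<lambda>i. mat_adjoint (L_slice n3 A i))"

definition identity_tensor :: "nat \<Rightarrow> nat \<Rightarrow> tensor" where
  "identity_tensor n n3 = tensor_of_L_slices n n n3 (\<lambda>_. 1\<^sub>m n)"

definition tensor_inverse :: "nat \<Rightarrow> tensor \<Rightarrow> tensor" where
  "tensor_inverse n3 B = (let n = dim_row B in
     (THE Y. Y \<in> carrier_tensor n n n3 \<and>
        B \<star>\<^bsub>n3\<^esub> Y = identity_tensor n n3 \<and> Y \<star>\<^bsub>n3\<^esub> B = identity_tensor n n3))"

definition unitary_tensor :: "nat \<Rightarrow> nat \<Rightarrow> tensor \<Rightarrow> bool" where
  "unitary_tensor n n3 Q \<longleftrightarrow> Q \<in> carrier_tensor n n n3 \<and>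
     tensor_adjoint n3 Q \<star>\<^bsub>n3\<^esub> Q = identity_tensor n n3 \<and>
     Q \<star>\<^bsub>n3\<^esub> tensor_adjoint n3 Q = identity_tensor n n3"

definition F_diagonal :: "nat \<Rightarrow> tensor \<Rightarrow> bool" where
  "F_diagonal n3 S \<longleftrightarrow> (\<forall>i<n3. diagonal_mat (frontal_slice S i))"

definition mat_rank :: "complex mat \<Rightarrow> nat" where
  "mat_rank A = vec_space.rank (dim_row A) A"

definition unitary_mat :: "nat \<Rightarrow> complex mat \<Rightarrow> bool" where
  "unitary_mat n Q \<longleftrightarrow> Q \<in> carrier_mat n n \<and>
     mat_adjoint Q * Q = 1\<^sub>m n \<and> Q * mat_adjoint Q = 1\<^sub>m n"

text \<open>Singular value decomposition of an \<open>m \<times> n\<close> matrix, with the nonzero singular values first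
  (they need not be sorted by size).\<close>

definition is_svd :: "nat \<Rightarrow> nat \<Rightarrow> complex mat \<Rightarrow> complex mat \<Rightarrow> complex mat \<Rightarrow> complex mat \<Rightarrow> bool" where
  "is_svd m n A U S V \<longleftrightarrow>
     unitary_mat m U \<and> unitary_mat n V \<and> S \<in> carrier_mat m n \<and>
     A = U * S * mat_adjoint V \<and>
     diagonal_mat S \<and>
     (\<forall>j<min m n. \<exists>s::real. 0 \<le> s \<and> S $$ (j, j) = complex_of_real s) \<and>
     (let r = mat_rank S in \<exists>D \<in> carrier_mat r r. diagonal_mat D \<and> invertible_mat D \<and>
        S = four_block_mat D (0\<^sub>m r (n - r)) (0\<^sub>m (m - r) r) (0\<^sub>m (m - r) (n - r)))"

definition is_C_SVD :: "nat \<Rightarrow> nat \<Rightarrow> nat \<Rightarrow> tensor \<Rightarrow> tensor \<Rightarrow> tensor \<Rightarrow> tensor \<Rightarrow> bool" where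
  "is_C_SVD m n n3 G U S V \<longleftrightarrow>
     unitary_tensor m n3 U \<and> unitary_tensor n n3 V \<and>
     S \<in> carrier_tensor m n n3 \<and> F_diagonal n3 S \<and>
     G = U \<star>\<^bsub>n3\<^esub> S \<star>\<^bsub>n3\<^esub> tensor_adjoint n3 V \<and>
     (\<forall>i<n3. is_svd m n (L_slice n3 G i) (L_slice n3 U i) (L_slice n3 S i) (L_slice n3 V i))"

definition is_inverse_along :: "nat \<Rightarrow> nat \<Rightarrow> nat \<Rightarrow> tensor \<Rightarrow> tensor \<Rightarrow> tensor \<Rightarrow> bool" where
  "is_inverse_along n1 n2 n3 A G Y \<longleftrightarrow>
     Y \<in> carrier_tensor n2 n1 n3 \<and>
     Y \<star>\<^bsub>n3\<^esub> A \<star>\<^bsub>n3\<^esub> G = G \<and>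
     G \<star>\<^bsub>n3\<^esub> A \<star>\<^bsub>n3\<^esub> Y = G \<and>
     (\<exists>E \<in> carrier_tensor n1 n1 n3. Y = G \<star>\<^bsub>n3\<^esub> E) \<and>
     (\<exists>F \<in> carrier_tensor n2 n2 n3. tensor_adjoint n3 Y = tensor_adjoint n3 G \<star>\<^bsub>n3\<^esub> F)"

definition invertible_along :: "nat \<Rightarrow> nat \<Rightarrow> nat \<Rightarrow> tensor \<Rightarrow> tensor \<Rightarrow> bool" where
  "invertible_along n1 n2 n3 A G \<longleftrightarrow> (\<exists>Y. is_inverse_along n1 n2 n3 A G Y)"

definition inverse_along :: "nat \<Rightarrow> nat \<Rightarrow> nat \<Rightarrow> tensor \<Rightarrow> tensor \<Rightarrow> tensor" where
  "inverse_along n1 n2 n3 A G = (THE Y. is_inverse_along n1 n2 n3 A G Y)"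

end

theory Submission
  imports Defs
begin

text \<open>
  The transform \<open>L\<close> applies one fixed matrix \<open>M\<close> to every tube of a tensor. Because \<open>M\<close> is invertible
  (\<open>det_M_mat_nonzero\<close>), \<open>L\<close> is a bijection, and a tensor is the same thing as an arbitrary family of
  matrices, its transformed frontal slices. The C-product, the conjugate transpose and all other
  notions act on these slices independently, so the tensor \<open>A\<close> has an inverse along \<open>G\<close> iff each slice
  of \<open>A\<close> has one along the corresponding slice of \<open>G\<close> (\<open>is_inverse_along_iff_slices\<close>). Invertibility of
  \<open>M\<close> rests on the orthogonality of the DCT matrix (\<open>dct_mat_orthogonal\<close>), which comes down to a
  telescoping sum of cosines.

  What remains is a statement about matrices. Writing \<open>G = U S V\<^sup>H\<close> and \<open>A = V B U\<^sup>H\<close>, the unitary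
  factors act as a change of basis, under which the defining conditions of an inverse are invariant
  (\<open>matrix_inverse_along_basis_iff\<close>). So \<open>Y\<close> is an inverse of \<open>A\<close> along \<open>G\<close> iff \<open>U\<^sup>H Y V\<close> is an
  inverse of \<open>B\<close> along \<open>S\<close>, where \<open>S\<close> is a nonsingular block \<open>D\<close> surrounded by zeros. The range
  conditions \<open>Y = G E\<close> and \<open>Y\<^sup>H = G\<^sup>H F\<close> force \<open>U\<^sup>H Y V\<close> to be concentrated in the same block as \<open>D\<close>; there
  the remaining equations say \<open>T X D = D\<close> and \<open>D X T = D\<close>, that is, \<open>T\<close> is the inverse of \<open>X\<close>
  (\<open>matrix_inverse_along_block_iff\<close>). Hence an inverse exists iff \<open>X\<close> is nonsingular, it is unique, and
  it is \<open>U\<close> times the block matrix with corner \<open>X\<^sup>-\<^sup>1\<close> times \<open>V\<^sup>H\<close>. When all ranks agree, the blocks \<open>X\<close>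
  of the single slices have the same size and form a tensor, and the formula holds for tensors
  verbatim.
\<close>

section \<open>Invertibility of the transform matrix\<close>

text \<open>
  The product formula \<open>2 sin h cos (2k+1)h = sin (2k+2)h - sin 2kh\<close> turns the sum of cosines into a
  telescoping one. Keeping \<open>sin h\<close> on the left avoids a case distinction on its vanishing.
\<close>

lemma sum_cos_odd_multiples_telescope:
  fixes h :: real and n :: nat
  shows "(\<Sum>k<n. cos (real (2 * k + 1) * h)) * (2 * sin h) = sin (real (2 * n) * h)"
proof (induction n)
  case 0
  show ?case by simp
next
  case (Suc n)
  have "cos (real (2 * n + 1) * h) * (2 * sin h)
      = sin (real (2 * n + 1) * h + h) - sin (real (2 * n + 1) * h - h)"
    by (simp add: sin_add sin_diff)
  also have "real (2 * n + 1) * h + h = real (2 * Suc n) * h"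
    by (simp add: algebra_simps)
  also have "real (2 * n + 1) * h - h = real (2 * n) * h"
    by (simp add: algebra_simps)
  finally show ?case
    using Suc.IH by (simp add: distrib_right)
qed

text \<open>
  For \<open>h = m\<pi>/(2n)\<close> the telescoped sum is \<open>sin m\<pi> = 0\<close>, and \<open>0 < m < 2n\<close> puts \<open>h\<close> strictly between
  \<open>0\<close> and \<open>\<pi>\<close>, where \<open>sin h\<close> can be cancelled.
\<close>

lemma sum_cos_midpoints_eq_0:
  assumes "0 < m" and "m < 2 * n"
  shows "(\<Sum>k<n. cos (real (2 * k + 1) * (real m * pi / (2 * real n)))) = 0"
proof -
  define h where "h = real m * pi / (2 * real n)"
  have n: "0 < n" using assms by simp
  have "real m * pi < (2 * real n) * pi"
    using assms by (intro mult_strict_right_mono) auto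
  then have "0 < h" and "h < pi"
    using assms n by (auto simp: h_def field_simps)
  then have "sin h \<noteq> 0"
    using sin_gt_zero by fastforce
  moreover have "sin (real (2 * n) * h) = 0"
    using n by (simp add: h_def)
  ultimately show ?thesis
    using sum_cos_odd_multiples_telescope[of h n] by (simp add: h_def)
qed

lemma dct_mat_carrier [simp]: "dct_mat n \<in> carrier_mat n n"
  by (simp add: dct_mat_def)

text \<open>
  A product of two cosines is half the sum of the cosines of the difference and the sum of the
  angles, so each inner product of DCT rows reduces to two of the sums above, for the frequencies
  \<open>\<bar>i - j\<bar>\<close> and \<open>i + j\<close>. Both are smaller than \<open>2n\<close>; only the frequency \<open>0\<close> contributes.
\<close>

lemma sum_cos_times_cos_midpoints:
  assumes "0 < n" and "i < n" and "j < n"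
  shows "(\<Sum>k<n. cos (real (i * (2 * k + 1)) * pi / (2 * real n)) *
                 cos (real (j * (2 * k + 1)) * pi / (2 * real n)))
       = (if i \<noteq> j then 0 else if i = 0 then real n else real n / 2)"
proof -
  define c where "c m = (\<Sum>k<n. cos (real (2 * k + 1) * (real m * pi / (2 * real n))))" for m
  define d where "d = (if j \<le> i then i - j else j - i)"
  have c0: "c 0 = real n" by (simp add: c_def)
  have c: "c m = 0" if "0 < m" "m < 2 * n" for m
    unfolding c_def using that by (rule sum_cos_midpoints_eq_0)
  have "cos (real (i * (2 * k + 1)) * pi / (2 * real n)) *
        cos (real (j * (2 * k + 1)) * pi / (2 * real n))
      = (cos (real (2 * k + 1) * (real d * pi / (2 * real n))) +
         cos (real (2 * k + 1) * (real (i + j) * pi / (2 * real n)))) / 2" for k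
  proof -
    define t where "t = real (2 * k + 1) * pi / (2 * real n)"
    have "cos (real i * t - real j * t) = cos (real d * t)"
    proof (cases "j \<le> i")
      case True
      then show ?thesis by (simp only: d_def if_True left_diff_distrib of_nat_diff)
    next
      case False
      then have "real i * t - real j * t = - (real d * t)"
        by (simp add: d_def left_diff_distrib of_nat_diff)
      then show ?thesis by (metis cos_minus)
    qed
    then have "cos (real i * t) * cos (real j * t)
      = (cos (real d * t) + cos (real (i + j) * t)) / 2"
      by (simp only: cos_times_cos of_nat_add distrib_right)
    then show ?thesis by (simp only: t_def of_nat_mult mult_ac times_divide_eq_right)
  qed
  then have "(\<Sum>k<n. cos (real (i * (2 * k + 1)) * pi / (2 * real n)) *
                 cos (real (j * (2 * k + 1)) * pi / (2 * real n))) = (c d + c (i + j)) / 2"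
    by (simp only: c_def sum.distrib sum_divide_distrib[symmetric])
  also have "\<dots> = (if i \<noteq> j then 0 else if i = 0 then real n else real n / 2)"
    using c0 c[of d] c[of "i + j"] assms by (auto simp: d_def)
  finally show ?thesis .
qed

text \<open>
  The square roots in the entries of the DCT matrix are exactly the factors that normalise the
  row norms computed in the previous lemma.
\<close>

lemma dct_mat_orthogonal:
  assumes "0 < n"
  shows "dct_mat n * transpose_mat (dct_mat n) = 1\<^sub>m n"
proof (rule eq_matI)
  fix i j assume "i < dim_row (1\<^sub>m n)" and "j < dim_col (1\<^sub>m n)"
  then have ij: "i < n" "j < n" by auto
  define s where "s j = sqrt ((2 - of_bool (j = 0)) / real n)" for j :: nat
  have "(dct_mat n * transpose_mat (dct_mat n)) $$ (i, j)
      = (\<Sum>k<n. s i * s j * (cos (real (i * (2 * k + 1)) * pi / (2 * real n)) *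
                 cos (real (j * (2 * k + 1)) * pi / (2 * real n))))"
    using ij by (simp add: dct_mat_def scalar_prod_def s_def atLeast0LessThan mult_ac)
  also have "\<dots> = s i * s j * (if i \<noteq> j then 0 else if i = 0 then real n else real n / 2)"
    using sum_cos_times_cos_midpoints[OF assms ij] by (simp only: sum_distrib_left[symmetric])
  also have "\<dots> = 1\<^sub>m n $$ (i, j)"
    using ij assms by (auto simp: s_def)
  finally show "(dct_mat n * transpose_mat (dct_mat n)) $$ (i, j) = 1\<^sub>m n $$ (i, j)" .
qed (auto simp: dct_mat_def)

lemma W_mat_carrier [simp]: "W_mat n \<in> carrier_mat n n"
  by (simp add: W_mat_def)

lemma Z_mat_carrier [simp]: "Z_mat n \<in> carrier_mat n n"
  by (simp add: Z_mat_def)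

text \<open>
  The first column of the DCT matrix has no zero entry: its angles \<open>j\<pi>/(2n)\<close> with \<open>j < n\<close> lie below
  \<open>\<pi>/2\<close>. So the option-valued inversion in the definition of \<^const>\<open>M_mat\<close> does succeed.
\<close>

lemma W_mat_inverse:
  assumes "0 < n"
  obtains W' where "mat_inverse (W_mat n) = Some W'" and "W' \<in> carrier_mat n n"
    and "W' * W_mat n = 1\<^sub>m n"
proof -
  have pos: "dct_mat n $$ (j, 0) > 0" if "j < n" for j
  proof -
    have "real j * pi < real n * pi"
      using that by (intro mult_strict_right_mono) auto
    then have "real j * pi / (2 * real n) < pi / 2"
      using that by (simp add: field_simps)
    then have "cos (real j * pi / (2 * real n)) > 0"
      using that by (intro cos_gt_zero_pi) (auto intro: less_le_trans[of _ 0])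
    then show ?thesis
      using that by (auto simp: dct_mat_def)
  qed
  have "upper_triangular (W_mat n)" by (auto simp: W_mat_def mat_diag_def)
  then have "det (W_mat n) = prod_list (diag_mat (W_mat n))"
    by (rule det_upper_triangular[of _ n]) simp
  also have "\<dots> \<noteq> 0"
    using pos by (fastforce simp: prod_list_zero_iff diag_mat_def W_mat_def mat_diag_def)
  finally have "W_mat n \<in> Units (ring_mat TYPE(real) n ())"
    by (rule det_non_zero_imp_unit[OF W_mat_carrier])
  then have "mat_inverse (W_mat n) \<noteq> None"
    using mat_inverse(1)[OF W_mat_carrier, where b = "()"] by (metis (no_types))
  then obtain W' where W': "mat_inverse (W_mat n) = Some W'"
    by blast
  show thesis
    using mat_inverse(2)[OF W_mat_carrier W'] that[OF W'] by metis
qed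

lemma M_mat_carrier:
  assumes "0 < n"
  shows "M_mat n \<in> carrier_mat n n"
proof -
  obtain W' where "mat_inverse (W_mat n) = Some W'" "W' \<in> carrier_mat n n"
    by (rule W_mat_inverse[OF assms])
  then show ?thesis
    by (auto simp: M_mat_def intro!: mult_carrier_mat[of _ n n])
qed

text \<open>
  All three factors of \<^const>\<open>M_mat\<close> have nonzero determinant: the first is the inverse of a matrix,
  the second is orthogonal, and the third is unitriangular.
\<close>

lemma det_M_mat_nonzero:
  assumes "0 < n"
  shows "det (M_mat n) \<noteq> 0"
proof -
  obtain W' where W': "mat_inverse (W_mat n) = Some W'" "W' \<in> carrier_mat n n"
    "W' * W_mat n = 1\<^sub>m n"
    by (rule W_mat_inverse[OF assms])
  have "det W' * det (W_mat n) = 1"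
    unfolding det_mult[OF W'(2) W_mat_carrier, symmetric] W'(3) by simp
  moreover have "det (dct_mat n) * det (transpose_mat (dct_mat n)) = 1"
    by (subst det_mult[symmetric, of _ n]) (simp_all add: dct_mat_orthogonal[OF assms])
  moreover have "det (1\<^sub>m n + Z_mat n) = 1"
  proof -
    have "upper_triangular (1\<^sub>m n + Z_mat n)" by (auto simp: Z_mat_def)
    then have "det (1\<^sub>m n + Z_mat n) = prod_list (diag_mat (1\<^sub>m n + Z_mat n))"
      by (rule det_upper_triangular[of _ n]) (intro add_carrier_mat Z_mat_carrier)
    also have "diag_mat (1\<^sub>m n + Z_mat n) = map (\<lambda>_. 1) [0..<n]"
      by (simp add: diag_mat_def Z_mat_def)
    finally show ?thesis by (simp add: map_replicate_const)
  qed
  moreover have "det (M_mat n) = det W' * det (dct_mat n) * det (1\<^sub>m n + Z_mat n)"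
    using W'(1,2) by (simp add: M_mat_def det_mult[of _ n] mult_carrier_mat[of _ n n])
  ultimately show ?thesis by auto
qed

lemma complex_M_mat_inverse:
  assumes "0 < n"
  obtains N where "N \<in> carrier_mat n n"
    and "N * map_mat complex_of_real (M_mat n) = 1\<^sub>m n"
    and "map_mat complex_of_real (M_mat n) * N = 1\<^sub>m n"
proof -
  have "det (map_mat complex_of_real (M_mat n)) = complex_of_real (det (M_mat n))"
    by (rule of_real_hom.hom_det)
  then have "det (map_mat complex_of_real (M_mat n)) \<noteq> 0"
    using det_M_mat_nonzero[OF assms] by (simp only: of_real_eq_0_iff not_False_eq_True)
  then have "map_mat complex_of_real (M_mat n) \<in> Units (ring_mat TYPE(complex) n ())"
    using M_mat_carrier[OF assms] by (intro det_non_zero_imp_unit) auto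
  then show thesis
    using that by (auto simp: Units_def ring_mat_def)
qed

section \<open>Tensors and their transformed frontal slices\<close>

lemma carrier_tensor_dims:
  assumes "A \<in> carrier_tensor m n n3"
  shows "dim_row A = m" and "dim_col A = n"
  using assms by (auto simp: carrier_tensor_def)

lemma L_slice_dims [simp]:
  "dim_row (L_slice n3 A i) = dim_row A" "dim_col (L_slice n3 A i) = dim_col A"
  by (simp_all add: frontal_slice_def L_def)

lemma L_slice_carrier:
  assumes "A \<in> carrier_tensor m n n3"
  shows "L_slice n3 A i \<in> carrier_mat m n"
  using carrier_tensor_dims[OF assms] by (intro carrier_matI) simp_all

lemma L_slice_index:
  assumes "a < dim_row A" and "b < dim_col A"
  shows "L_slice n3 A i $$ (a, b) = (map_mat complex_of_real (M_mat n3) *\<^sub>v A $$ (a, b)) $ i"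
  using assms by (simp add: frontal_slice_def L_def)

text \<open>
  The entry of the \<open>i\<close>-th transformed slice at \<open>(a, b)\<close> is the \<open>i\<close>-th component of \<open>M v\<close> for the tube
  \<open>v\<close> at \<open>(a, b)\<close>. Since \<open>M\<close> is invertible, the slices determine every tube; and conversely they can
  be prescribed freely, by applying the inverse of \<open>M\<close> to each tube of prescribed values. The
  definite description behind \<^const>\<open>tensor_of_L_slices\<close> therefore always denotes, and the C-product,
  adjoint, identity and zero tensors have the slices that their definitions promise.
\<close>

lemma tensor_eq_if_L_slices_eq:
  assumes n3: "0 < n3"
    and A: "A \<in> carrier_tensor m n n3" and B: "B \<in> carrier_tensor m n n3"
    and eq: "\<And>i. i < n3 \<Longrightarrow> L_slice n3 A i = L_slice n3 B i"
  shows "A = B"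
proof (rule eq_matI)
  fix a b assume "a < dim_row B" and "b < dim_col B"
  then have ab: "a < m" "b < n" using carrier_tensor_dims[OF B] by auto
  let ?M = "map_mat complex_of_real (M_mat n3)"
  obtain N where N: "N \<in> carrier_mat n3 n3" "N * ?M = 1\<^sub>m n3"
    by (rule complex_M_mat_inverse[OF n3])
  have M: "?M \<in> carrier_mat n3 n3" using M_mat_carrier[OF n3] by simp
  have v: "A $$ (a, b) \<in> carrier_vec n3" "B $$ (a, b) \<in> carrier_vec n3"
    using A B ab by (auto simp: carrier_tensor_def)
  have "?M *\<^sub>v A $$ (a, b) = ?M *\<^sub>v B $$ (a, b)"
  proof (rule eq_vecI)
    fix i assume "i < dim_vec (?M *\<^sub>v B $$ (a, b))"
    then have "i < n3" using M by simp
    then have "L_slice n3 A i $$ (a, b) = L_slice n3 B i $$ (a, b)"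
      using eq by simp
    then show "(?M *\<^sub>v A $$ (a, b)) $ i = (?M *\<^sub>v B $$ (a, b)) $ i"
      using ab carrier_tensor_dims[OF A] carrier_tensor_dims[OF B]
      by (simp only: L_slice_index)
  qed simp
  then have "(N * ?M) *\<^sub>v A $$ (a, b) = (N * ?M) *\<^sub>v B $$ (a, b)"
    using N(1) M v by (simp only: assoc_mult_mat_vec)
  then show "A $$ (a, b) = B $$ (a, b)"
    using v N(2) by simp
qed (simp_all add: carrier_tensor_dims[OF A] carrier_tensor_dims[OF B])

lemma ex_tensor_with_L_slices:
  assumes n3: "0 < n3" and F: "\<And>i. i < n3 \<Longrightarrow> F i \<in> carrier_mat m n"
  shows "\<exists>A \<in> carrier_tensor m n n3. \<forall>i<n3. L_slice n3 A i = F i"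
proof -
  let ?M = "map_mat complex_of_real (M_mat n3)"
  obtain N where N: "N \<in> carrier_mat n3 n3" "?M * N = 1\<^sub>m n3"
    by (rule complex_M_mat_inverse[OF n3])
  have M: "?M \<in> carrier_mat n3 n3" using M_mat_carrier[OF n3] by simp
  define A where "A = mat m n (\<lambda>(a, b). N *\<^sub>v vec n3 (\<lambda>i. F i $$ (a, b)))"
  have A: "A \<in> carrier_tensor m n n3"
    using N(1) by (simp add: carrier_tensor_def A_def)
  have "L_slice n3 A i = F i" if i: "i < n3" for i
  proof (rule eq_matI)
    fix a b assume "a < dim_row (F i)" and "b < dim_col (F i)"
    then have ab: "a < m" "b < n" using F[OF i] by auto
    have "L_slice n3 A i $$ (a, b) = (?M *\<^sub>v (N *\<^sub>v vec n3 (\<lambda>i. F i $$ (a, b)))) $ i"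
      using ab by (subst L_slice_index) (simp_all add: A_def)
    also have "?M *\<^sub>v (N *\<^sub>v vec n3 (\<lambda>i. F i $$ (a, b)))
        = (?M * N) *\<^sub>v vec n3 (\<lambda>i. F i $$ (a, b))"
      by (rule assoc_mult_mat_vec[symmetric, OF M N(1)]) simp
    also have "\<dots> $ i = F i $$ (a, b)"
      using i by (simp add: N(2))
    finally show "L_slice n3 A i $$ (a, b) = F i $$ (a, b)" .
  qed (use F[OF i] in \<open>simp_all add: A_def\<close>)
  with A show ?thesis by blast
qed

lemma tensor_of_L_slices:
  assumes n3: "0 < n3" and F: "\<And>i. i < n3 \<Longrightarrow> F i \<in> carrier_mat m n"
  shows "tensor_of_L_slices m n n3 F \<in> carrier_tensor m n n3"
    and "\<And>i. i < n3 \<Longrightarrow> L_slice n3 (tensor_of_L_slices m n n3 F) i = F i"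
proof -
  have "\<exists>!A. A \<in> carrier_tensor m n n3 \<and> (\<forall>i<n3. L_slice n3 A i = F i)"
  proof (rule ex_ex1I)
    show "\<exists>A. A \<in> carrier_tensor m n n3 \<and> (\<forall>i<n3. L_slice n3 A i = F i)"
      using ex_tensor_with_L_slices[where F = F, OF n3 F] by blast
  next
    fix A B
    assume "A \<in> carrier_tensor m n n3 \<and> (\<forall>i<n3. L_slice n3 A i = F i)"
      and "B \<in> carrier_tensor m n n3 \<and> (\<forall>i<n3. L_slice n3 B i = F i)"
    then show "A = B"
      using tensor_eq_if_L_slices_eq[OF n3] by metis
  qed
  from theI'[OF this]
  show "tensor_of_L_slices m n n3 F \<in> carrier_tensor m n n3"
    and "\<And>i. i < n3 \<Longrightarrow> L_slice n3 (tensor_of_L_slices m n n3 F) i = F i"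
    unfolding tensor_of_L_slices_def by auto
qed

lemma c_prod:
  assumes n3: "0 < n3" and A: "A \<in> carrier_tensor m k n3" and B: "B \<in> carrier_tensor k n n3"
  shows "A \<star>\<^bsub>n3\<^esub> B \<in> carrier_tensor m n n3"
    and "\<And>i. i < n3 \<Longrightarrow> L_slice n3 (A \<star>\<^bsub>n3\<^esub> B) i = L_slice n3 A i * L_slice n3 B i"
proof -
  have F: "L_slice n3 A i * L_slice n3 B i \<in> carrier_mat m n" for i
    using L_slice_carrier[OF A] L_slice_carrier[OF B] by (rule mult_carrier_mat)
  show "A \<star>\<^bsub>n3\<^esub> B \<in> carrier_tensor m n n3"
    and "\<And>i. i < n3 \<Longrightarrow> L_slice n3 (A \<star>\<^bsub>n3\<^esub> B) i = L_slice n3 A i * L_slice n3 B i"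
    using tensor_of_L_slices[OF n3 F]
    by (simp_all add: c_prod_def carrier_tensor_dims[OF A] carrier_tensor_dims[OF B])
qed

lemma mat_adjoint_carrier:
  assumes "A \<in> carrier_mat m n"
  shows "mat_adjoint A \<in> carrier_mat n m"
  using assms by (auto simp: mat_adjoint_def)

lemma tensor_adjoint:
  assumes n3: "0 < n3" and A: "A \<in> carrier_tensor m n n3"
  shows "tensor_adjoint n3 A \<in> carrier_tensor n m n3"
    and "\<And>i. i < n3 \<Longrightarrow> L_slice n3 (tensor_adjoint n3 A) i = mat_adjoint (L_slice n3 A i)"
proof -
  have F: "mat_adjoint (L_slice n3 A i) \<in> carrier_mat n m" for i
    using L_slice_carrier[OF A] by (rule mat_adjoint_carrier)
  show "tensor_adjoint n3 A \<in> carrier_tensor n m n3"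
    and "\<And>i. i < n3 \<Longrightarrow> L_slice n3 (tensor_adjoint n3 A) i = mat_adjoint (L_slice n3 A i)"
    using tensor_of_L_slices[OF n3 F]
    by (simp_all add: tensor_adjoint_def carrier_tensor_dims[OF A])
qed

lemma identity_tensor:
  assumes n3: "0 < n3"
  shows "identity_tensor n n3 \<in> carrier_tensor n n n3"
    and "\<And>i. i < n3 \<Longrightarrow> L_slice n3 (identity_tensor n n3) i = 1\<^sub>m n"
  using tensor_of_L_slices[OF n3, of "\<lambda>_. 1\<^sub>m n" n n] by (simp_all add: identity_tensor_def)

lemma zero_tensor:
  assumes n3: "0 < n3"
  shows "zero_tensor m n n3 \<in> carrier_tensor m n n3"
    and "\<And>i. i < n3 \<Longrightarrow> L_slice n3 (zero_tensor m n n3) i = 0\<^sub>m m n"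
proof -
  show "zero_tensor m n n3 \<in> carrier_tensor m n n3"
    by (simp add: carrier_tensor_def zero_tensor_def)
  show "L_slice n3 (zero_tensor m n n3) i = 0\<^sub>m m n" if i: "i < n3" for i
  proof (rule eq_matI)
    fix a b assume "a < dim_row (0\<^sub>m m n)" and "b < dim_col (0\<^sub>m m n)"
    then show "L_slice n3 (zero_tensor m n n3) i $$ (a, b) = 0\<^sub>m m n $$ (a, b)"
      using i M_mat_carrier[OF n3]
      by (subst L_slice_index) (auto simp: zero_tensor_def scalar_prod_def)
  qed (simp_all add: zero_tensor_def)
qed

lemma four_block_tensor:
  assumes A: "A \<in> carrier_tensor m k n3" and B: "B \<in> carrier_tensor m l n3"
    and C: "C \<in> carrier_tensor p k n3" and D: "D \<in> carrier_tensor p l n3"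
  shows "four_block_mat A B C D \<in> carrier_tensor (m + p) (k + l) n3"
    and "L_slice n3 (four_block_mat A B C D) i =
      four_block_mat (L_slice n3 A i) (L_slice n3 B i) (L_slice n3 C i) (L_slice n3 D i)"
proof -
  have carr: "A \<in> carrier_mat m k" "B \<in> carrier_mat m l" "C \<in> carrier_mat p k" "D \<in> carrier_mat p l"
    using assms by (auto simp: carrier_tensor_def)
  show "four_block_mat A B C D \<in> carrier_tensor (m + p) (k + l) n3"
    using assms by (auto simp: carrier_tensor_def)
  show "L_slice n3 (four_block_mat A B C D) i =
      four_block_mat (L_slice n3 A i) (L_slice n3 B i) (L_slice n3 C i) (L_slice n3 D i)"
    unfolding frontal_slice_def L_def
    by (rule eq_matI) (use carr in auto)
qed

text \<open>
  One-sided inverse slices suffice, because square matrices over a field with a left inverse are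
  invertible. The result evaluates the definite description defining \<^const>\<open>tensor_inverse\<close>.
\<close>

lemma tensor_inverse_eqI:
  assumes n3: "0 < n3" and B: "B \<in> carrier_tensor n n n3" and Y: "Y \<in> carrier_tensor n n n3"
    and YB: "\<And>i. i < n3 \<Longrightarrow> L_slice n3 Y i * L_slice n3 B i = 1\<^sub>m n"
  shows "tensor_inverse n3 B = Y"
proof -
  note carr = L_slice_carrier[OF B] L_slice_carrier[OF Y]
  have BY: "L_slice n3 B i * L_slice n3 Y i = 1\<^sub>m n" if "i < n3" for i
    using carr YB[OF that] by (intro mat_mult_left_right_inverse[of "L_slice n3 Y i"])
  have prod: "P \<star>\<^bsub>n3\<^esub> Q = identity_tensor n n3 \<longleftrightarrow>
      (\<forall>i<n3. L_slice n3 P i * L_slice n3 Q i = 1\<^sub>m n)"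
    if P: "P \<in> carrier_tensor n n n3" and Q: "Q \<in> carrier_tensor n n n3" for P Q
  proof
    assume "P \<star>\<^bsub>n3\<^esub> Q = identity_tensor n n3"
    then show "\<forall>i<n3. L_slice n3 P i * L_slice n3 Q i = 1\<^sub>m n"
      using c_prod(2)[OF n3 P Q] identity_tensor(2)[OF n3] by metis
  next
    assume "\<forall>i<n3. L_slice n3 P i * L_slice n3 Q i = 1\<^sub>m n"
    then show "P \<star>\<^bsub>n3\<^esub> Q = identity_tensor n n3"
      by (intro tensor_eq_if_L_slices_eq[OF n3 c_prod(1)[OF n3 P Q] identity_tensor(1)[OF n3]])
        (simp add: c_prod(2)[OF n3 P Q] identity_tensor(2)[OF n3])
  qed
  show ?thesis
    unfolding tensor_inverse_def Let_def carrier_tensor_dims[OF B]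
  proof (rule the_equality)
    show "Y \<in> carrier_tensor n n n3 \<and>
        B \<star>\<^bsub>n3\<^esub> Y = identity_tensor n n3 \<and> Y \<star>\<^bsub>n3\<^esub> B = identity_tensor n n3"
      using Y YB BY by (simp add: prod[OF Y B] prod[OF B Y])
  next
    fix Z
    assume Z: "Z \<in> carrier_tensor n n n3 \<and>
        B \<star>\<^bsub>n3\<^esub> Z = identity_tensor n n3 \<and> Z \<star>\<^bsub>n3\<^esub> B = identity_tensor n n3"
    show "Z = Y"
    proof (rule tensor_eq_if_L_slices_eq[OF n3 _ Y])
      fix i assume i: "i < n3"
      have Zi: "L_slice n3 Z i \<in> carrier_mat n n"
        using Z L_slice_carrier by blast
      have BZ: "L_slice n3 B i * L_slice n3 Z i = 1\<^sub>m n"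
        using Z i prod[OF B] by blast
      have "L_slice n3 Y i * L_slice n3 B i * L_slice n3 Z i
          = L_slice n3 Y i * (L_slice n3 B i * L_slice n3 Z i)"
        by (rule assoc_mult_mat[OF carr(2,1) Zi])
      then show "L_slice n3 Z i = L_slice n3 Y i"
        using left_mult_one_mat[OF Zi] right_mult_one_mat[OF carr(2)] by (simp add: YB[OF i] BZ)
    qed (use Z in blast)
  qed
qed

section \<open>The inverse of a matrix along another matrix\<close>

text \<open>
  Associativity and cancellation with premises on dimensions only: unlike the carrier versions, these
  leave no undetermined dimension when used as rewrite rules.
\<close>

lemma assoc_mult_mat_dim:
  fixes A B C :: "'a::semiring_0 mat"
  assumes "dim_col A = dim_row B" and "dim_col B = dim_row C"
  shows "A * B * C = A * (B * C)"
  using assms by (intro assoc_mult_mat) auto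

lemma mult_inverse_cancel_left:
  fixes P Q A :: "'a::semiring_1 mat"
  assumes "P * Q = 1\<^sub>m n" and "dim_col P = dim_row Q" and "dim_row A = dim_col Q"
  shows "P * (Q * A) = A"
proof -
  have "dim_col Q = n"
    using arg_cong[OF assms(1), of dim_col] by simp
  then show ?thesis
    using assms by (simp add: assoc_mult_mat_dim[symmetric])
qed

text \<open>
  The slice-wise form of the inverse along a tensor. The condition \<open>Y\<^sup>H = G\<^sup>H F\<close> is replaced by the
  equivalent \<open>Y = H G\<close>. In this form it makes sense over any semiring and is visibly invariant
  under changes of basis that are merely invertible.
\<close>

definition matrix_inverse_along ::
    "nat \<Rightarrow> nat \<Rightarrow> 'a::semiring_1 mat \<Rightarrow> 'a mat \<Rightarrow> 'a mat \<Rightarrow> bool" where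
  "matrix_inverse_along n1 n2 A G Y \<longleftrightarrow>
     Y \<in> carrier_mat n2 n1 \<and> Y * A * G = G \<and> G * A * Y = G \<and>
     (\<exists>E \<in> carrier_mat n1 n1. Y = G * E) \<and> (\<exists>H \<in> carrier_mat n2 n2. Y = H * G)"

text \<open>
  Each adjacent pair \<open>U' U\<close> or \<open>V' V\<close> in the products cancels; the factors \<open>E\<close> and \<open>H\<close> become
  \<open>V E V'\<close> and \<open>U H U'\<close>.
\<close>

lemma matrix_inverse_along_change_basis:
  fixes U V S B Y :: "'a::semiring_1 mat"
  assumes [simp]: "U \<in> carrier_mat n2 n2" "U' \<in> carrier_mat n2 n2"
      "V \<in> carrier_mat n1 n1" "V' \<in> carrier_mat n1 n1"
      "S \<in> carrier_mat n2 n1" "B \<in> carrier_mat n1 n2"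
    and U: "U' * U = 1\<^sub>m n2" and V: "V' * V = 1\<^sub>m n1"
    and Y: "matrix_inverse_along n1 n2 B S Y"
  shows "matrix_inverse_along n1 n2 (V * B * U') (U * S * V') (U * Y * V')"
proof -
  note [simp] = carrier_matD[OF assms(1)] carrier_matD[OF assms(2)] carrier_matD[OF assms(3)]
    carrier_matD[OF assms(4)] carrier_matD[OF assms(5)] carrier_matD[OF assms(6)]
  note assoc = assoc_mult_mat_dim
  note cancel = mult_inverse_cancel_left[OF U] mult_inverse_cancel_left[OF V]
  from Y obtain E H where [simp]: "Y \<in> carrier_mat n2 n1"
    and YBS: "Y * B * S = S" and SBY: "S * B * Y = S"
    and E [simp]: "E \<in> carrier_mat n1 n1" "Y = S * E"
    and H [simp]: "H \<in> carrier_mat n2 n2" and YH: "Y = H * S"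
    unfolding matrix_inverse_along_def by blast
  have [simp]: "dim_row E = n1" "dim_col E = n1" "dim_row H = n2" "dim_col H = n2"
    using carrier_matD[OF E(1)] carrier_matD[OF H] by blast+
  have Yd: "dim_row Y = n2" "dim_col Y = n1" by simp_all
  have 1: "U * Y * V' * (V * B * U') * (U * S * V') = U * (Y * B * S) * V'"
    using Yd by (simp add: assoc cancel del: E(2))
  have 2: "U * S * V' * (V * B * U') * (U * Y * V') = U * (S * B * Y) * V'"
    using Yd by (simp add: assoc cancel del: E(2))
  have 3: "U * Y * V' = U * S * V' * (V * E * V')"
    by (simp add: assoc cancel)
  have 4: "U * Y * V' = U * H * U' * (U * S * V')"
    unfolding YH by (simp add: assoc cancel)
  show ?thesis
    unfolding matrix_inverse_along_def
  proof (intro conjI)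
    show "U * Y * V' \<in> carrier_mat n2 n1"
      using Yd by (intro carrier_matI) (simp_all del: E(2))
    show "\<exists>E \<in> carrier_mat n1 n1. U * Y * V' = U * S * V' * E"
      by (rule bexI[of _ "V * E * V'"], rule 3) (intro carrier_matI; simp)
    show "\<exists>H \<in> carrier_mat n2 n2. U * Y * V' = H * (U * S * V')"
      by (rule bexI[of _ "U * H * U'"], rule 4) (intro carrier_matI; simp)
  qed (simp_all only: 1 2 YBS SBY)
qed

text \<open>
  Over a field the left inverses \<open>U'\<close> and \<open>V'\<close> are two-sided, so the change of basis can be undone by
  the previous lemma with the roles of \<open>U, U'\<close> and of \<open>V, V'\<close> exchanged.
\<close>

lemma matrix_inverse_along_basis_iff:
  fixes U V S B Z :: "'a::field mat"
  assumes carr: "U \<in> carrier_mat n2 n2" "U' \<in> carrier_mat n2 n2"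
      "V \<in> carrier_mat n1 n1" "V' \<in> carrier_mat n1 n1"
      "S \<in> carrier_mat n2 n1" "B \<in> carrier_mat n1 n2"
    and U: "U' * U = 1\<^sub>m n2" and V: "V' * V = 1\<^sub>m n1"
  shows "matrix_inverse_along n1 n2 (V * B * U') (U * S * V') Z \<longleftrightarrow>
    (\<exists>Y. matrix_inverse_along n1 n2 B S Y \<and> Z = U * Y * V')" (is "?L \<longleftrightarrow> ?R")
proof
  assume ?R
  then obtain Y where "matrix_inverse_along n1 n2 B S Y" and "Z = U * Y * V'"
    by blast
  with matrix_inverse_along_change_basis[OF carr U V] show ?L
    by simp
next
  assume L: ?L
  have U2: "U * U' = 1\<^sub>m n2"
    by (rule mat_mult_left_right_inverse[OF carr(2,1) U])
  have V2: "V * V' = 1\<^sub>m n1"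
    by (rule mat_mult_left_right_inverse[OF carr(4,3) V])
  note [simp] = carrier_matD[OF carr(1)] carrier_matD[OF carr(2)] carrier_matD[OF carr(3)]
    carrier_matD[OF carr(4)] carrier_matD[OF carr(5)] carrier_matD[OF carr(6)]
  note simps = assoc_mult_mat_dim mult_inverse_cancel_left[OF U] mult_inverse_cancel_left[OF V]
    mult_inverse_cancel_left[OF U2] mult_inverse_cancel_left[OF V2] U V U2 V2
  have "matrix_inverse_along n1 n2 (V' * (V * B * U') * U) (U' * (U * S * V') * V) (U' * Z * V)"
    by (rule matrix_inverse_along_change_basis[OF carr(2,1,4,3) _ _ U2 V2 L])
      (intro carrier_matI; simp)+
  moreover have "V' * (V * B * U') * U = B" and "U' * (U * S * V') * V = S"
    by (simp_all add: simps)
  moreover have "Z = U * (U' * Z * V) * V'"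
  proof -
    from L have "dim_row Z = n2" "dim_col Z = n1"
      unfolding matrix_inverse_along_def by auto
    then show ?thesis by (simp add: simps)
  qed
  ultimately show ?R by auto
qed

lemma four_block_mat_inject:
  assumes "four_block_mat A B C D = four_block_mat A' B' C' D'"
    and "A \<in> carrier_mat m k" "B \<in> carrier_mat m l" "C \<in> carrier_mat p k" "D \<in> carrier_mat p l"
    and "A' \<in> carrier_mat m k" "B' \<in> carrier_mat m l" "C' \<in> carrier_mat p k" "D' \<in> carrier_mat p l"
  shows "A = A'" and "B = B'" and "C = C'" and "D = D'"
proof -
  have eq: "four_block_mat A B C D $$ (i, j) = four_block_mat A' B' C' D' $$ (i, j)" for i j
    using assms(1) by simp
  note carr = assms(2-)
  show "A = A'"
  proof (rule eq_matI)
    fix i j assume "i < dim_row A'" "j < dim_col A'"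
    then show "A $$ (i, j) = A' $$ (i, j)" using eq[of i j] carr by auto
  qed (use carr in auto)
  show "B = B'"
  proof (rule eq_matI)
    fix i j assume "i < dim_row B'" "j < dim_col B'"
    then show "B $$ (i, j) = B' $$ (i, j)" using eq[of i "k + j"] carr by auto
  qed (use carr in auto)
  show "C = C'"
  proof (rule eq_matI)
    fix i j assume "i < dim_row C'" "j < dim_col C'"
    then show "C $$ (i, j) = C' $$ (i, j)" using eq[of "m + i" j] carr by auto
  qed (use carr in auto)
  show "D = D'"
  proof (rule eq_matI)
    fix i j assume "i < dim_row D'" "j < dim_col D'"
    then show "D $$ (i, j) = D' $$ (i, j)" using eq[of "m + i" "k + j"] carr by auto
  qed (use carr in auto)
qed

text \<open>
  The heart of the matter. A multiple \<open>S E\<close> has zero lower block rows and a multiple \<open>H S\<close> has zero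
  right block columns, so an inverse along \<open>S\<close> is concentrated in a block \<open>T\<close> in the upper left
  corner. The equation \<open>Y B S = S\<close> then reads \<open>T X D = D\<close> in that corner, i.e. \<open>T X = 1\<close>. Conversely,
  for such \<open>T\<close> the unspecified blocks \<open>P, Q, R\<close> drop out of \<open>Y B S\<close> and \<open>S B Y\<close>, because they meet a zero
  block of \<open>S\<close> or of \<open>Y\<close>.
\<close>

lemma matrix_inverse_along_block_iff:
  fixes D X P Q R Y :: "'a::field mat"
  assumes D: "D \<in> carrier_mat r r" "D' \<in> carrier_mat r r" "D * D' = 1\<^sub>m r"
    and X: "X \<in> carrier_mat r r"
    and PQR: "P \<in> carrier_mat r q" "Q \<in> carrier_mat p r" "R \<in> carrier_mat p q"
  defines "S \<equiv> four_block_mat D (0\<^sub>m r p) (0\<^sub>m q r) (0\<^sub>m q p)"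
    and "B \<equiv> four_block_mat X P Q R"
  shows "matrix_inverse_along (r + p) (r + q) B S Y \<longleftrightarrow>
    (\<exists>T \<in> carrier_mat r r. T * X = 1\<^sub>m r \<and>
       Y = four_block_mat T (0\<^sub>m r p) (0\<^sub>m q r) (0\<^sub>m q p))" (is "?L \<longleftrightarrow> ?R")
proof
  note mult = mult_four_block_mat[where ?nr1.0 = r and ?n1.0 = r and ?nc1.0 = r]
  assume ?L
  then obtain E H where E: "E \<in> carrier_mat (r + p) (r + p)" "Y = S * E"
    and H: "H \<in> carrier_mat (r + q) (r + q)" "Y = H * S" and YBS: "Y * B * S = S"
    unfolding matrix_inverse_along_def by blast
  obtain E1 E2 E3 E4 where "split_block E r r = (E1, E2, E3, E4)"
    by (metis prod_cases4)
  from split_block[OF this, of p p] E(1)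
  have E1: "E1 \<in> carrier_mat r r" "E2 \<in> carrier_mat r p" "E3 \<in> carrier_mat p r"
    "E4 \<in> carrier_mat p p" "E = four_block_mat E1 E2 E3 E4" by auto
  obtain H1 H2 H3 H4 where "split_block H r r = (H1, H2, H3, H4)"
    by (metis prod_cases4)
  from split_block[OF this, of q q] H(1)
  have H1: "H1 \<in> carrier_mat r r" "H2 \<in> carrier_mat r q" "H3 \<in> carrier_mat q r"
    "H4 \<in> carrier_mat q q" "H = four_block_mat H1 H2 H3 H4" by auto
  \<comment> \<open>Comparing both forms of \<open>Y\<close> annihilates all blocks but the upper left one.\<close>
  have Y1: "Y = four_block_mat (D * E1) (D * E2) (0\<^sub>m q r) (0\<^sub>m q p)"
    unfolding E(2) E1(5) S_def using D E1
    by (subst mult[where ?n2.0 = p and ?nr2.0 = q and ?nc2.0 = p]) auto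
  have Y2: "Y = four_block_mat (H1 * D) (0\<^sub>m r p) (H3 * D) (0\<^sub>m q p)"
    unfolding H(2) H1(5) S_def using D H1
    by (subst mult[where ?n2.0 = q and ?nr2.0 = q and ?nc2.0 = p]) auto
  define T where "T = D * E1"
  have T: "T \<in> carrier_mat r r" using D E1 by (simp add: T_def)
  have "D * E2 = 0\<^sub>m r p"
    by (rule four_block_mat_inject(2)[where m = r and k = r and l = p and p = q,
          OF Y1[symmetric, unfolded Y2]])
      (use D(1) E1(1-4) H1(1-4) in auto)
  with Y1 have Y: "Y = four_block_mat T (0\<^sub>m r p) (0\<^sub>m q r) (0\<^sub>m q p)"
    by (simp add: T_def)
  have "Y * B = four_block_mat (T * X) (T * P) (0\<^sub>m q r) (0\<^sub>m q q)"
    unfolding Y B_def using T X PQR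
    by (subst mult[where ?n2.0 = p and ?nr2.0 = q and ?nc2.0 = q]) auto
  then have "Y * B * S = four_block_mat (T * X * D) (0\<^sub>m r p) (0\<^sub>m q r) (0\<^sub>m q p)"
    unfolding S_def using T X D PQR
    by (simp, subst mult[where ?n2.0 = q and ?nr2.0 = q and ?nc2.0 = p]) auto
  then have eq: "four_block_mat (T * X * D) (0\<^sub>m r p) (0\<^sub>m q r) (0\<^sub>m q p)
      = four_block_mat D (0\<^sub>m r p) (0\<^sub>m q r) (0\<^sub>m q p)"
    using YBS by (simp add: S_def)
  have "T * X * D = D"
    by (rule four_block_mat_inject(1)[where m = r and k = r and l = p and p = q, OF eq]) (use T X D in auto)
  moreover have "T * X * D * D' = T * X * (D * D')"
    by (rule assoc_mult_mat[of _ r r _ r _ r]) (use T X D(1,2) in auto)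
  ultimately have "T * X = 1\<^sub>m r"
    using T X D by simp
  with T Y show ?R by blast
next
  note mult = mult_four_block_mat[where ?nr1.0 = r and ?n1.0 = r and ?nc1.0 = r]
  assume ?R
  then obtain T where T: "T \<in> carrier_mat r r" and TX: "T * X = 1\<^sub>m r"
    and Y: "Y = four_block_mat T (0\<^sub>m r p) (0\<^sub>m q r) (0\<^sub>m q p)" by blast
  have D'D: "D' * D = 1\<^sub>m r" by (rule mat_mult_left_right_inverse[OF D])
  have XT: "X * T = 1\<^sub>m r" by (rule mat_mult_left_right_inverse[OF T X TX])
  have "Y * B = four_block_mat (1\<^sub>m r) (T * P) (0\<^sub>m q r) (0\<^sub>m q q)"
    unfolding Y B_def using T X PQR TX
    by (subst mult[where ?n2.0 = p and ?nr2.0 = q and ?nc2.0 = q]) auto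
  then have YBS: "Y * B * S = S"
    unfolding S_def using T X D PQR
    by (simp, subst mult[where ?n2.0 = q and ?nr2.0 = q and ?nc2.0 = p]) auto
  have "B * Y = four_block_mat (1\<^sub>m r) (0\<^sub>m r p) (Q * T) (0\<^sub>m p p)"
    unfolding Y B_def using T X PQR XT
    by (subst mult[where ?n2.0 = q and ?nr2.0 = p and ?nc2.0 = p]) auto
  then have "S * (B * Y) = S"
    unfolding S_def using T X D PQR
    by (simp, subst mult[where ?n2.0 = p and ?nr2.0 = q and ?nc2.0 = p]) auto
  then have SBY: "S * B * Y = S"
    using assms(1-7) T by (simp add: assoc_mult_mat_dim Y S_def B_def)
  \<comment> \<open>Dividing by \<open>D\<close> on the appropriate side exhibits \<open>T\<close> as a multiple of \<open>D\<close>.\<close>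
  have SE: "Y = S * four_block_mat (D' * T) (0\<^sub>m r p) (0\<^sub>m p r) (0\<^sub>m p p)"
    unfolding Y S_def using D T
    by (subst mult[where ?n2.0 = p and ?nr2.0 = q and ?nc2.0 = p])
      (auto simp: assoc_mult_mat_dim mult_inverse_cancel_left[OF D(3)])
  have HS: "Y = four_block_mat (T * D') (0\<^sub>m r q) (0\<^sub>m q r) (0\<^sub>m q q) * S"
    unfolding Y S_def using D T D'D
    by (subst mult[where ?n2.0 = q and ?nr2.0 = q and ?nc2.0 = p])
      (auto simp: assoc_mult_mat_dim)
  show ?L
    unfolding matrix_inverse_along_def
  proof (intro conjI)
    show "Y \<in> carrier_mat (r + q) (r + p)"
      using T by (simp add: Y)
    show "\<exists>E \<in> carrier_mat (r + p) (r + p). Y = S * E"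
      by (rule bexI[of _ "four_block_mat (D' * T) (0\<^sub>m r p) (0\<^sub>m p r) (0\<^sub>m p p)"], rule SE)
        (use D T in auto)
    show "\<exists>H \<in> carrier_mat (r + q) (r + q). Y = H * S"
      by (rule bexI[of _ "four_block_mat (T * D') (0\<^sub>m r q) (0\<^sub>m q r) (0\<^sub>m q q)"], rule HS)
        (use D T in auto)
  qed (fact YBS SBY)+
qed

section \<open>The inverse along a tensor in terms of slices\<close>

lemma mat_adjoint_dims [simp]:
  "dim_row (mat_adjoint A) = dim_col A" "dim_col (mat_adjoint A) = dim_row A"
  by (simp_all add: mat_adjoint_def)

lemma mat_adjoint_index:
  assumes "i < dim_row A" and "j < dim_col A"
  shows "mat_adjoint A $$ (j, i) = conjugate (A $$ (i, j))"
  using assms by (simp add: mat_adjoint_def mat_of_rows_def)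

lemma mat_adjoint_adjoint [simp]: "mat_adjoint (mat_adjoint A) = A"
  by (rule eq_matI) (simp_all add: mat_adjoint_index)

lemma mat_adjoint_mult:
  assumes "dim_col A = dim_row B"
  shows "mat_adjoint (A * B) = mat_adjoint B * mat_adjoint A"
proof (rule eq_matI)
  fix j i assume "j < dim_row (mat_adjoint B * mat_adjoint A)"
    and "i < dim_col (mat_adjoint B * mat_adjoint A)"
  then have ij: "i < dim_row A" "j < dim_col B" by auto
  have carr: "row A i \<in> carrier_vec (dim_row B)" "col B j \<in> carrier_vec (dim_row B)"
    by (rule carrier_vecI, simp add: assms)+
  have "row (mat_adjoint B) j = conjugate (col B j)" "col (mat_adjoint A) i = conjugate (row A i)"
    using ij by (auto intro!: eq_vecI simp: mat_adjoint_index)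
  then have "(mat_adjoint B * mat_adjoint A) $$ (j, i) = conjugate (col B j) \<bullet> conjugate (row A i)"
    using ij by simp
  also have "\<dots> = conjugate (row A i) \<bullet> conjugate (col B j)"
    by (rule comm_scalar_prod[OF carrier_vec_conjugate[OF carr(2)] carrier_vec_conjugate[OF carr(1)]])
  also have "\<dots> = conjugate (row A i \<bullet> col B j)"
    by (rule conjugate_sprod_vec[symmetric, OF carr])
  finally show "mat_adjoint (A * B) $$ (j, i) = (mat_adjoint B * mat_adjoint A) $$ (j, i)"
    using ij by (simp add: mat_adjoint_index)
qed simp_all

text \<open>
  Taking adjoints exchanges the two sides, with \<open>F\<close> and \<open>H\<close> adjoint to each other.
\<close>

lemma adjoint_factor_iff:
  fixes Y G :: "complex mat"
  assumes Y: "Y \<in> carrier_mat n2 n1" and G: "G \<in> carrier_mat n2 n1"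
  shows "(\<exists>F \<in> carrier_mat n2 n2. mat_adjoint Y = mat_adjoint G * F) \<longleftrightarrow>
    (\<exists>H \<in> carrier_mat n2 n2. Y = H * G)"
proof
  assume "\<exists>F \<in> carrier_mat n2 n2. mat_adjoint Y = mat_adjoint G * F"
  then obtain F where F: "F \<in> carrier_mat n2 n2" and eq: "mat_adjoint Y = mat_adjoint G * F"
    by blast
  have "Y = mat_adjoint (mat_adjoint G * F)"
    by (simp add: eq[symmetric])
  also have "\<dots> = mat_adjoint F * G"
    using F G by (simp add: mat_adjoint_mult)
  finally show "\<exists>H \<in> carrier_mat n2 n2. Y = H * G"
    using mat_adjoint_carrier[OF F] by blast
next
  assume "\<exists>H \<in> carrier_mat n2 n2. Y = H * G"
  then obtain H where H: "H \<in> carrier_mat n2 n2" and eq: "Y = H * G"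
    by blast
  have "mat_adjoint Y = mat_adjoint G * mat_adjoint H"
    using H G by (simp add: eq mat_adjoint_mult)
  then show "\<exists>F \<in> carrier_mat n2 n2. mat_adjoint Y = mat_adjoint G * F"
    using mat_adjoint_carrier[OF H] by blast
qed

lemma ex_tensor_factor_iff:
  assumes n3: "0 < n3" and Y: "Y \<in> carrier_tensor m n n3" and G: "G \<in> carrier_tensor m k n3"
  shows "(\<exists>E \<in> carrier_tensor k n n3. Y = G \<star>\<^bsub>n3\<^esub> E) \<longleftrightarrow>
    (\<forall>i<n3. \<exists>E \<in> carrier_mat k n. L_slice n3 Y i = L_slice n3 G i * E)"
proof
  assume "\<exists>E \<in> carrier_tensor k n n3. Y = G \<star>\<^bsub>n3\<^esub> E"
  then obtain E where E: "E \<in> carrier_tensor k n n3" and eq: "Y = G \<star>\<^bsub>n3\<^esub> E"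
    by blast
  show "\<forall>i<n3. \<exists>E \<in> carrier_mat k n. L_slice n3 Y i = L_slice n3 G i * E"
    using c_prod(2)[OF n3 G E] L_slice_carrier[OF E] eq by blast
next
  assume "\<forall>i<n3. \<exists>E \<in> carrier_mat k n. L_slice n3 Y i = L_slice n3 G i * E"
  then obtain E where E: "\<And>i. i < n3 \<Longrightarrow> E i \<in> carrier_mat k n"
    and eq: "\<And>i. i < n3 \<Longrightarrow> L_slice n3 Y i = L_slice n3 G i * E i"
    by metis
  note T = tensor_of_L_slices[where F = E, OF n3 E]
  have "Y = G \<star>\<^bsub>n3\<^esub> tensor_of_L_slices k n n3 E"
    by (rule tensor_eq_if_L_slices_eq[OF n3 Y c_prod(1)[OF n3 G T(1)]])
      (simp_all add: eq c_prod(2)[OF n3 G T(1)] T(2))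
  with T(1) show "\<exists>E \<in> carrier_tensor k n n3. Y = G \<star>\<^bsub>n3\<^esub> E"
    by blast
qed

text \<open>
  Every condition on the inverse along a tensor is an equation between C-products, hence a family of
  independent matrix equations; the existentially quantified factors can be chosen slice by slice and
  assembled to a tensor.
\<close>

lemma is_inverse_along_iff_slices:
  assumes n3: "0 < n3" and A: "A \<in> carrier_tensor n1 n2 n3" and G: "G \<in> carrier_tensor n2 n1 n3"
  shows "is_inverse_along n1 n2 n3 A G Y \<longleftrightarrow> Y \<in> carrier_tensor n2 n1 n3 \<and>
    (\<forall>i<n3. matrix_inverse_along n1 n2 (L_slice n3 A i) (L_slice n3 G i) (L_slice n3 Y i))"
proof (cases "Y \<in> carrier_tensor n2 n1 n3")
  case Y: True
  have triple_prod: "P \<star>\<^bsub>n3\<^esub> A \<star>\<^bsub>n3\<^esub> Q = G \<longleftrightarrow>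
      (\<forall>i<n3. L_slice n3 P i * L_slice n3 A i * L_slice n3 Q i = L_slice n3 G i)"
    if P: "P \<in> carrier_tensor n2 n1 n3" and Q: "Q \<in> carrier_tensor n2 n1 n3" for P Q
  proof -
    note PA = c_prod[OF n3 P A]
    note PAQ = c_prod[OF n3 PA(1) Q]
    have "P \<star>\<^bsub>n3\<^esub> A \<star>\<^bsub>n3\<^esub> Q = G \<longleftrightarrow>
        (\<forall>i<n3. L_slice n3 (P \<star>\<^bsub>n3\<^esub> A \<star>\<^bsub>n3\<^esub> Q) i = L_slice n3 G i)"
      using tensor_eq_if_L_slices_eq[OF n3 PAQ(1) G] by auto
    then show ?thesis by (simp add: PAQ(2) PA(2))
  qed
  note Y_adj = tensor_adjoint[OF n3 Y] and G_adj = tensor_adjoint[OF n3 G]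
  have "(\<exists>F \<in> carrier_tensor n2 n2 n3. tensor_adjoint n3 Y = tensor_adjoint n3 G \<star>\<^bsub>n3\<^esub> F) \<longleftrightarrow>
      (\<forall>i<n3. \<exists>H \<in> carrier_mat n2 n2. L_slice n3 Y i = H * L_slice n3 G i)"
    by (simp add: ex_tensor_factor_iff[OF n3 Y_adj(1) G_adj(1)] Y_adj(2) G_adj(2)
        adjoint_factor_iff[OF L_slice_carrier[OF Y] L_slice_carrier[OF G]])
  then show ?thesis
    unfolding is_inverse_along_def matrix_inverse_along_def
    using Y L_slice_carrier[OF Y] triple_prod[OF Y G] triple_prod[OF G Y]
      ex_tensor_factor_iff[OF n3 Y G] by auto
qed (simp add: is_inverse_along_def)

section \<open>Inverses along a matrix with a known singular value decomposition\<close>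

lemma invertible_mat_iff_left_inverse:
  fixes X :: "'a::field mat"
  assumes X: "X \<in> carrier_mat r r"
  shows "invertible_mat X \<longleftrightarrow> (\<exists>T \<in> carrier_mat r r. T * X = 1\<^sub>m r)"
proof
  assume "invertible_mat X"
  then obtain T where XT: "X * T = 1\<^sub>m (dim_row X)" and TX: "T * X = 1\<^sub>m (dim_row T)"
    unfolding invertible_mat_def inverts_mat_def by blast
  have dims: "dim_col T = r" "dim_row T = r"
    using arg_cong[OF XT, of dim_col] arg_cong[OF TX, of dim_col] X by simp_all
  have "T \<in> carrier_mat r r"
    using dims by (intro carrier_matI)
  with TX show "\<exists>T \<in> carrier_mat r r. T * X = 1\<^sub>m r"
    unfolding dims by (rule bexI)
next
  assume "\<exists>T \<in> carrier_mat r r. T * X = 1\<^sub>m r"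
  then obtain T where T: "T \<in> carrier_mat r r" and TX: "T * X = 1\<^sub>m r"
    by blast
  have "X * T = 1\<^sub>m r"
    by (rule mat_mult_left_right_inverse[OF T X TX])
  then have "inverts_mat X T \<and> inverts_mat T X"
    using T X TX by (simp add: inverts_mat_def)
  moreover have "square_mat X"
    using X by simp
  ultimately show "invertible_mat X"
    unfolding invertible_mat_def by blast
qed

lemma left_inverse_mat_unique:
  fixes X T T' :: "'a::field mat"
  assumes X: "X \<in> carrier_mat r r" and T: "T \<in> carrier_mat r r" "T * X = 1\<^sub>m r"
    and T': "T' \<in> carrier_mat r r" "T' * X = 1\<^sub>m r"
  shows "T = T'"
proof -
  have "X * T' = 1\<^sub>m r"
    by (rule mat_mult_left_right_inverse[OF T'(1) X T'(2)])
  moreover have "T * X * T' = T * (X * T')"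
    by (rule assoc_mult_mat[OF T(1) X T'(1)])
  ultimately show ?thesis
    using T T' by simp
qed

text \<open>
  These bounds make the truncated differences in the block sizes honest: \<open>r + (n - r) = n\<close>.
\<close>

lemma svd_rank_le:
  assumes "is_svd m n A U S V"
  shows "mat_rank S \<le> m" and "mat_rank S \<le> n"
proof -
  let ?r = "mat_rank S"
  from assms obtain D where "D \<in> carrier_mat ?r ?r"
    and "S = four_block_mat D (0\<^sub>m ?r (n - ?r)) (0\<^sub>m (m - ?r) ?r) (0\<^sub>m (m - ?r) (n - ?r))"
    unfolding is_svd_def Let_def by blast
  then have "dim_row S = ?r + (m - ?r)" and "dim_col S = ?r + (n - ?r)"
    by (metis four_block_carrier_mat zero_carrier_mat carrier_matD)+
  moreover have "S \<in> carrier_mat m n"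
    using assms unfolding is_svd_def by blast
  ultimately show "?r \<le> m" and "?r \<le> n"
    using carrier_matD[of S m n] by simp_all
qed

text \<open>
  The matrix case of the theorem. The adjoints of the unitary factors are their inverses, so the
  problem can be moved to the bases in which \<open>G\<close> is \<open>S\<close> and \<open>A\<close> is the
  block matrix.
\<close>

lemma matrix_inverse_along_svd_iff:
  assumes svd: "is_svd n2 n1 G U S V" and r: "mat_rank S = r"
    and X: "X \<in> carrier_mat r r" and P: "P \<in> carrier_mat r (n2 - r)"
    and Q: "Q \<in> carrier_mat (n1 - r) r" and R: "R \<in> carrier_mat (n1 - r) (n2 - r)"
    and A: "A = V * four_block_mat X P Q R * mat_adjoint U"
  shows "matrix_inverse_along n1 n2 A G Z \<longleftrightarrow>
    (\<exists>T \<in> carrier_mat r r. T * X = 1\<^sub>m r \<and>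
       Z = U * four_block_mat T (0\<^sub>m r (n1 - r)) (0\<^sub>m (n2 - r) r) (0\<^sub>m (n2 - r) (n1 - r))
             * mat_adjoint V)"
proof -
  from svd have U: "U \<in> carrier_mat n2 n2" "mat_adjoint U * U = 1\<^sub>m n2"
    and V: "V \<in> carrier_mat n1 n1" "mat_adjoint V * V = 1\<^sub>m n1"
    and S: "S \<in> carrier_mat n2 n1" and G: "G = U * S * mat_adjoint V"
    unfolding is_svd_def unitary_mat_def by blast+
  from svd r obtain D where D: "D \<in> carrier_mat r r" and D_inv: "invertible_mat D"
    and S_block: "S = four_block_mat D (0\<^sub>m r (n1 - r)) (0\<^sub>m (n2 - r) r) (0\<^sub>m (n2 - r) (n1 - r))"
    unfolding is_svd_def Let_def by blast
  have rn: "r + (n1 - r) = n1" "r + (n2 - r) = n2"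
    using svd_rank_le[OF svd] r by simp_all
  from D_inv obtain D' where D': "D' \<in> carrier_mat r r" "D' * D = 1\<^sub>m r"
    using invertible_mat_iff_left_inverse[OF D] by blast
  have DD': "D * D' = 1\<^sub>m r"
    by (rule mat_mult_left_right_inverse[OF D'(1) D D'(2)])
  have B: "four_block_mat X P Q R \<in> carrier_mat n1 n2"
    using four_block_carrier_mat[OF X R] by (simp add: rn)
  have block: "matrix_inverse_along n1 n2 (four_block_mat X P Q R) S Y \<longleftrightarrow>
      (\<exists>T \<in> carrier_mat r r. T * X = 1\<^sub>m r \<and>
         Y = four_block_mat T (0\<^sub>m r (n1 - r)) (0\<^sub>m (n2 - r) r) (0\<^sub>m (n2 - r) (n1 - r)))" for Y
    unfolding S_block
    using matrix_inverse_along_block_iff[OF D D'(1) DD' X P Q R] by (simp only: rn)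
  show ?thesis
    unfolding A G matrix_inverse_along_basis_iff[OF U(1) mat_adjoint_carrier[OF U(1)] V(1)
        mat_adjoint_carrier[OF V(1)] S B U(2) V(2)] block
    by blast
qed

section \<open>Existence and form of the inverse along a tensor\<close>

theorem theorem5p4:
  fixes n1 n2 n3 :: nat
    and A G U S V B :: tensor
    and r :: "nat \<Rightarrow> nat"
    and X :: "nat \<Rightarrow> complex mat"
  assumes "n3 > 0"
    and "A \<in> carrier_tensor n1 n2 n3"
    and "G \<in> carrier_tensor n2 n1 n3"
    and "is_C_SVD n2 n1 n3 G U S V"
    and "\<And>i. i < n3 \<Longrightarrow> mat_rank (L_slice n3 S i) = r i"
    and "B \<in> carrier_tensor n1 n2 n3"
    and "A = V \<star>\<^bsub>n3\<^esub> B \<star>\<^bsub>n3\<^esub> tensor_adjoint n3 U"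
    and "\<And>i. i < n3 \<Longrightarrow> X i \<in> carrier_mat (r i) (r i)"
    and "\<And>i. i < n3 \<Longrightarrow>
           \<exists>P \<in> carrier_mat (r i) (n2 - r i).
           \<exists>Q \<in> carrier_mat (n1 - r i) (r i).
           \<exists>R \<in> carrier_mat (n1 - r i) (n2 - r i).
             L_slice n3 B i = four_block_mat (X i) P Q R"
  shows "(invertible_along n1 n2 n3 A G \<longleftrightarrow> (\<forall>i<n3. invertible_mat (X i))) \<and>
    (\<forall>k. (\<forall>i<n3. r i = k) \<longrightarrow> invertible_along n1 n2 n3 A G \<longrightarrow>
       inverse_along n1 n2 n3 A G =
         U \<star>\<^bsub>n3\<^esub>
         four_block_mat (tensor_inverse n3 (tensor_of_L_slices k k n3 X))
           (zero_tensor k (n1 - k) n3)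
           (zero_tensor (n2 - k) k n3) (zero_tensor (n2 - k) (n1 - k) n3)
         \<star>\<^bsub>n3\<^esub> tensor_adjoint n3 V)"
proof -
  note n3 = assms(1) and A = assms(2) and G = assms(3) and B = assms(6) and X = assms(8)
  have U: "U \<in> carrier_tensor n2 n2 n3" and V: "V \<in> carrier_tensor n1 n1 n3"
    and svd: "\<And>i. i < n3 \<Longrightarrow>
      is_svd n2 n1 (L_slice n3 G i) (L_slice n3 U i) (L_slice n3 S i) (L_slice n3 V i)"
    using assms(4) unfolding is_C_SVD_def unitary_tensor_def by blast+
  note U_adj = tensor_adjoint[OF n3 U] and V_adj = tensor_adjoint[OF n3 V]
  \<comment> \<open>the only possible form of the \<open>i\<close>-th transformed slice of an inverse, for \<open>T\<close> the inverse of \<open>X i\<close>\<close>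
  define Y where "Y i T = L_slice n3 U i *
      four_block_mat T (0\<^sub>m (r i) (n1 - r i)) (0\<^sub>m (n2 - r i) (r i)) (0\<^sub>m (n2 - r i) (n1 - r i)) *
      mat_adjoint (L_slice n3 V i)" for i T
  have A_slice: "L_slice n3 A i =
      L_slice n3 V i * L_slice n3 B i * mat_adjoint (L_slice n3 U i)" if "i < n3" for i
    using that c_prod[OF n3 V B] by (simp add: assms(7) c_prod(2)[OF n3 _ U_adj(1)] U_adj(2))
  have slice: "matrix_inverse_along n1 n2 (L_slice n3 A i) (L_slice n3 G i) Z \<longleftrightarrow>
      (\<exists>T \<in> carrier_mat (r i) (r i). T * X i = 1\<^sub>m (r i) \<and> Z = Y i T)" if i: "i < n3" for i Z
  proof -
    obtain P Q R where "P \<in> carrier_mat (r i) (n2 - r i)" "Q \<in> carrier_mat (n1 - r i) (r i)"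
      "R \<in> carrier_mat (n1 - r i) (n2 - r i)" "L_slice n3 B i = four_block_mat (X i) P Q R"
      using assms(9)[OF i] by blast
    then show ?thesis
      unfolding Y_def
      using matrix_inverse_along_svd_iff[OF svd[OF i] assms(5)[OF i] X[OF i]] A_slice[OF i]
      by simp
  qed
  have inverse_iff: "is_inverse_along n1 n2 n3 A G Z \<longleftrightarrow> Z \<in> carrier_tensor n2 n1 n3 \<and>
      (\<forall>i<n3. \<exists>T \<in> carrier_mat (r i) (r i). T * X i = 1\<^sub>m (r i) \<and> L_slice n3 Z i = Y i T)" for Z
    by (simp add: is_inverse_along_iff_slices[OF n3 A G] slice)
  have inverse_unique: "Z = Z'"
    if Z: "is_inverse_along n1 n2 n3 A G Z" and Z': "is_inverse_along n1 n2 n3 A G Z'" for Z Z'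
  proof (rule tensor_eq_if_L_slices_eq[where m = n2 and n = n1, OF n3])
    fix i assume i: "i < n3"
    obtain T where T: "T \<in> carrier_mat (r i) (r i)" "T * X i = 1\<^sub>m (r i)" "L_slice n3 Z i = Y i T"
      using Z i unfolding inverse_iff by blast
    obtain T' where T': "T' \<in> carrier_mat (r i) (r i)" "T' * X i = 1\<^sub>m (r i)"
      "L_slice n3 Z' i = Y i T'"
      using Z' i unfolding inverse_iff by blast
    have "T = T'"
      by (rule left_inverse_mat_unique[OF X[OF i] T(1,2) T'(1,2)])
    with T(3) T'(3) show "L_slice n3 Z i = L_slice n3 Z' i" by simp
  qed (use Z Z' in \<open>simp_all add: inverse_iff\<close>)
  have exists_iff: "invertible_along n1 n2 n3 A G \<longleftrightarrow>
      (\<forall>i<n3. \<exists>T \<in> carrier_mat (r i) (r i). T * X i = 1\<^sub>m (r i))"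
  proof
    assume "invertible_along n1 n2 n3 A G"
    then show "\<forall>i<n3. \<exists>T \<in> carrier_mat (r i) (r i). T * X i = 1\<^sub>m (r i)"
      unfolding invertible_along_def inverse_iff by blast
  next
    assume "\<forall>i<n3. \<exists>T \<in> carrier_mat (r i) (r i). T * X i = 1\<^sub>m (r i)"
    then obtain T where T: "\<And>i. i < n3 \<Longrightarrow> T i \<in> carrier_mat (r i) (r i)"
      "\<And>i. i < n3 \<Longrightarrow> T i * X i = 1\<^sub>m (r i)"
      by metis
    have "matrix_inverse_along n1 n2 (L_slice n3 A i) (L_slice n3 G i) (Y i (T i))"
      if "i < n3" for i
      using T that slice by blast
    then have "Y i (T i) \<in> carrier_mat n2 n1" if "i < n3" for i
      using that by (simp add: matrix_inverse_along_def)
    from tensor_of_L_slices[where F = "\<lambda>i. Y i (T i)", OF n3 this] T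
    have "is_inverse_along n1 n2 n3 A G (tensor_of_L_slices n2 n1 n3 (\<lambda>i. Y i (T i)))"
      unfolding inverse_iff by blast
    then show "invertible_along n1 n2 n3 A G"
      unfolding invertible_along_def by blast
  qed
  show ?thesis
  proof (intro conjI allI impI)
    show "invertible_along n1 n2 n3 A G \<longleftrightarrow> (\<forall>i<n3. invertible_mat (X i))"
      using exists_iff invertible_mat_iff_left_inverse[OF X] by simp
  next
    fix k
    assume k: "\<forall>i<n3. r i = k" and "invertible_along n1 n2 n3 A G"
    then obtain T where T: "\<And>i. i < n3 \<Longrightarrow> T i \<in> carrier_mat k k"
      and TX: "\<And>i. i < n3 \<Longrightarrow> T i * X i = 1\<^sub>m k"
      unfolding exists_iff by metis
    define Ti where "Ti = tensor_of_L_slices k k n3 T"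
    let ?Y = "four_block_mat (tensor_inverse n3 (tensor_of_L_slices k k n3 X))
        (zero_tensor k (n1 - k) n3) (zero_tensor (n2 - k) k n3) (zero_tensor (n2 - k) (n1 - k) n3)"
    note Ti = tensor_of_L_slices[where F = T, OF n3 T, folded Ti_def]
    have X_carrier: "X i \<in> carrier_mat k k" if "i < n3" for i
      using X[OF that] k that by simp
    note X_tensor = tensor_of_L_slices[where F = X, OF n3 X_carrier]
    have inv: "tensor_inverse n3 (tensor_of_L_slices k k n3 X) = Ti"
      by (rule tensor_inverse_eqI[OF n3 X_tensor(1) Ti(1)]) (simp_all add: Ti(2) X_tensor(2) TX)
    note zero = zero_tensor[OF n3]
    \<comment> \<open>The common value \<open>k\<close> is constrained by the rank of slice \<open>0\<close>, which is present as \<open>n3 > 0\<close>.\<close>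
    have "k \<le> n1" and "k \<le> n2"
      using svd_rank_le[OF svd[OF n3]] assms(5)[OF n3] k n3 by simp_all
    then have "k + (n1 - k) = n1" "k + (n2 - k) = n2"
      by simp_all
    with four_block_tensor[OF Ti(1) zero(1)[of k "n1 - k"] zero(1)[of "n2 - k" k] zero(1)]
    have Y: "?Y \<in> carrier_tensor n2 n1 n3"
      and Y_slice: "\<And>i. L_slice n3 ?Y i = four_block_mat (L_slice n3 Ti i)
        (L_slice n3 (zero_tensor k (n1 - k) n3) i) (L_slice n3 (zero_tensor (n2 - k) k n3) i)
        (L_slice n3 (zero_tensor (n2 - k) (n1 - k) n3) i)"
      by (simp_all add: inv)
    note UY = c_prod[OF n3 U Y]
    note UYV = c_prod[OF n3 UY(1) V_adj(1)]
    have "L_slice n3 (U \<star>\<^bsub>n3\<^esub> ?Y \<star>\<^bsub>n3\<^esub> tensor_adjoint n3 V) i = Y i (T i)" if "i < n3" for i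
      using that k by (simp add: Y_def UYV(2) UY(2) V_adj(2) Y_slice Ti(2) zero(2))
    then have "is_inverse_along n1 n2 n3 A G (U \<star>\<^bsub>n3\<^esub> ?Y \<star>\<^bsub>n3\<^esub> tensor_adjoint n3 V)"
      unfolding inverse_iff using UYV(1) T TX k by blast
    then show "inverse_along n1 n2 n3 A G = U \<star>\<^bsub>n3\<^esub> ?Y \<star>\<^bsub>n3\<^esub> tensor_adjoint n3 V"
      unfolding inverse_along_def using inverse_unique by (intro the_equality) auto
  qed
qed

end
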